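(* Let $d\ge3$ and $2^*=\frac{2d}{d-2}$. There exist $\beta>0$, an odd function $f\in C(\mathbb R)$, locally Lipschitz on $\mathbb R\setminus\{0\}$, such that $f(s)=|s|^{2^*-2}s$ whenever $|s|\ge\beta$ and such that $F(s):=\int_0^sf(t)\,dt$ satisfies $F(s)<0$ for all $s\in(-\beta,\beta)\setminus\{0\}$ and $F(\pm\beta)=0$, and a number $\lambda_0>\beta$, such that for any $\lambda\ge\lambda_0$ the solution $v_\lambda$ of $$\big(r^{d-1}v'\big)'+r^{d-1}f(v)=0,\quad r>0,\qquad v(0)=\lambda,\quad v'(0)=0,$$ is everywhere positive on $[0,\infty)$.
   Context: Solutions are classical: $v\in C^1([0,\infty);\mathbb R)$ with $r^{d-1}v'\in C^1((0,\infty);\mathbb R)$. *)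

theory Defs
  imports "HOL-Analysis.Analysis"
begin

definition critical_exponent :: "nat \<Rightarrow> real" where
  "critical_exponent d = 2 * real d / (real d - 2)"

text \<open>Oriented integral: for \<open>s < 0\<close> this is minus the integral over \<open>[s, 0]\<close>.\<close>

definition primitive_from_0 :: "(real \<Rightarrow> real) \<Rightarrow> real \<Rightarrow> real" where
  "primitive_from_0 f s = (LBINT t=ereal 0..ereal s. f t)"

text \<open>
  Classical solutions of the radial initial value problem. Here \<open>v'\<close> is the derivative of \<open>v\<close> on
  \<open>[0, \<infinity>)\<close>, one-sided at \<open>0\<close>, and \<open>w'\<close> is the derivative of \<open>r \<mapsto> r^(d-1) v'(r)\<close> on
  \<open>(0, \<infinity>)\<close>. Only the values of \<open>v\<close> on \<open>[0, \<infinity>)\<close> matter.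
\<close>

definition radial_solution ::
    "nat \<Rightarrow> (real \<Rightarrow> real) \<Rightarrow> real \<Rightarrow> (real \<Rightarrow> real) \<Rightarrow> bool" where
  "radial_solution d f l v \<longleftrightarrow>
     (\<exists>v' w'.
        (\<forall>r\<ge>0. (v has_real_derivative v' r) (at r within {0..})) \<and>
        continuous_on {0..} v' \<and>
        (\<forall>r>0. ((\<lambda>r. r ^ (d - 1) * v' r) has_real_derivative w' r) (at r)) \<and>
        continuous_on {0<..} w' \<and>
        (\<forall>r>0. w' r + r ^ (d - 1) * f (v r) = 0) \<and>
        v 0 = l \<and> v' 0 = 0)"

end

theory Submission
  imports Defs
begin

text \<open>
  Take \<open>\<beta> = 1\<close> and, with \<open>k = (d - 2) / 2\<close>, the primitive
  \<open>F(s) = k/2 (|s|^(2 + 2/k) - s^2)\<close> on \<open>[-1, 1]\<close>, so that \<open>f\<close> is locally Lipschitz even at \<open>0\<close>;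
  here \<open>2/k = 2* - 2\<close>. Then \<open>2 d F(s) < (d - 2) s f(s)\<close> for all \<open>s > 0\<close>, so as long as \<open>v > 0\<close> the
  Pohozaev function
  \<open>r^d (v'^2 / 2 + F(v)) + (d - 2)/2 r^(d - 1) v v'\<close> decreases strictly from its value \<open>0\<close> at \<open>r = 0\<close>.
  At a zero of \<open>v\<close> it would be nonnegative, hence \<open>v\<close> has no zero, whatever the initial value.
  A solution is obtained by truncating \<open>f\<close> outside \<open>[0, l]\<close>, which makes the integral equation a
  contraction in an exponentially weighted norm; the solution stays in \<open>(0, l]\<close> (below \<open>l\<close> because the
  energy \<open>v'^2 / 2 + F(v)\<close> decreases), so the truncation is not felt.
\<close>

subsection \<open>Radial solutions: uniqueness and positivity\<close>

text \<open>Dividing \<open>r ^ (d - 1) * v' r\<close> by its weight on \<open>r > 0\<close> gives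
  the second-order form \<open>v'' = - f v - (d - 1) v' / r\<close>, which all energy arguments
  differentiate. At the singular point \<open>0\<close> only continuity and the initial values are
  kept.\<close>

lemma radial_solutionE:
  assumes "radial_solution d f l v"
  obtains v' where
    "\<And>r. r > 0 \<Longrightarrow> (v has_real_derivative v' r) (at r)"
    "\<And>r. r > 0 \<Longrightarrow> (v' has_real_derivative - f (v r) - real (d - 1) * v' r / r) (at r)"
    "continuous_on {0..} v" "continuous_on {0..} v'" "v 0 = l" "v' 0 = 0"
proof -
  from assms obtain v' w' where
    v': "\<And>r. r \<ge> 0 \<Longrightarrow> (v has_real_derivative v' r) (at r within {0..})"
    and c: "continuous_on {0..} v'"
    and w': "\<And>r. r > 0 \<Longrightarrow> ((\<lambda>r. r ^ (d - 1) * v' r) has_real_derivative w' r) (at r)"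
    and eq: "\<And>r. r > 0 \<Longrightarrow> w' r + r ^ (d - 1) * f (v r) = 0"
    and ini: "v 0 = l" "v' 0 = 0"
    unfolding radial_solution_def by blast
  have cv: "continuous_on {0..} v"
    using DERIV_continuous_on[of "{0..}" v v'] v' by simp
  have 1: "(v has_real_derivative v' r) (at r)" if "r > 0" for r
  proof -
    have "at r within {0..} = at r"
      using that by (intro at_within_interior) auto
    then show ?thesis using v'[of r] that by simp
  qed
  have 2: "(v' has_real_derivative - f (v r) - real (d - 1) * v' r / r) (at r)" if r: "r > 0" for r
  proof -
    let ?n = "d - 1"
    have "((\<lambda>r. r ^ ?n * v' r / r ^ ?n) has_real_derivative
        (w' r * r ^ ?n - r ^ ?n * v' r * (real ?n * (1 * r ^ (?n - Suc 0)))) / (r ^ ?n * r ^ ?n)) (at r)"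
      using r by (intro DERIV_divide w' DERIV_power DERIV_ident) auto
    moreover have "eventually (\<lambda>x. v' x = x ^ ?n * v' x / x ^ ?n) (nhds r)"
      by (rule eventually_mono[OF eventually_nhds_in_open[of "{0<..}" r]]) (use r in auto)
    ultimately have "(v' has_real_derivative
        (w' r * r ^ ?n - r ^ ?n * v' r * (real ?n * (1 * r ^ (?n - Suc 0)))) / (r ^ ?n * r ^ ?n)) (at r)"
      by (subst DERIV_cong_ev[OF refl _ refl])
    moreover have "(w' r * r ^ ?n - r ^ ?n * v' r * (real ?n * (1 * r ^ (?n - Suc 0)))) / (r ^ ?n * r ^ ?n)
        = - f (v r) - real ?n * v' r / r"
    proof -
      have w: "w' r = - (r ^ ?n * f (v r))" using eq[OF r] by linarith
      show ?thesis
      \<comment> \<open>The power rule leaves the truncated exponent \<open>?n - Suc 0\<close>; for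
        \<open>?n = 0\<close> the factor \<open>real ?n\<close> removes that term.\<close>
      proof (cases ?n)
        case (Suc m)
        then show ?thesis
          using r by (simp add: w field_simps)
      qed (simp add: w)
    qed
    ultimately show ?thesis by metis
  qed
  show thesis
    using that[OF 1 2 cv c ini] .
qed

text \<open>Gronwall argument for the squared phase-space distance: on the compact interval up to
  \<open>R\<close> both solutions are bounded, so one Lipschitz constant \<open>L\<close> serves
  both, and the distance weighted by \<open>exp (- (L + 1) * r)\<close> cannot grow from its initial
  value \<open>0\<close>.\<close>

lemma radial_solution_unique:
  assumes v: "radial_solution d f l v" and w: "radial_solution d f l w"
    and lip: "\<And>M. \<exists>L. L-lipschitz_on {-M..M} f" and "R \<ge> 0"
  shows "w R = v R"
proof -
  obtain v' where v':
    "\<And>r. r > 0 \<Longrightarrow> (v has_real_derivative v' r) (at r)"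
    "\<And>r. r > 0 \<Longrightarrow> (v' has_real_derivative - f (v r) - real (d - 1) * v' r / r) (at r)"
    "continuous_on {0..} v" "continuous_on {0..} v'" "v 0 = l" "v' 0 = 0"
    using v by (rule radial_solutionE) blast
  obtain w' where w':
    "\<And>r. r > 0 \<Longrightarrow> (w has_real_derivative w' r) (at r)"
    "\<And>r. r > 0 \<Longrightarrow> (w' has_real_derivative - f (w r) - real (d - 1) * w' r / r) (at r)"
    "continuous_on {0..} w" "continuous_on {0..} w'" "w 0 = l" "w' 0 = 0"
    using w by (rule radial_solutionE) blast
  note con = v'(3,4) w'(3,4)
  have con': "continuous_on {0..R} v" "continuous_on {0..R} v'" "continuous_on {0..R} w" "continuous_on {0..R} w'"
    using con by (auto elim: continuous_on_subset)
  obtain M1 where M1: "\<And>r. r \<in> {0..R} \<Longrightarrow> \<bar>v r\<bar> \<le> M1"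
    using compact_imp_bounded[OF compact_continuous_image[OF con'(1) compact_Icc]]
    unfolding bounded_iff real_norm_def by blast
  obtain M2 where M2: "\<And>r. r \<in> {0..R} \<Longrightarrow> \<bar>w r\<bar> \<le> M2"
    using compact_imp_bounded[OF compact_continuous_image[OF con'(3) compact_Icc]]
    unfolding bounded_iff real_norm_def by blast
  obtain L where L: "L-lipschitz_on {- max M1 M2..max M1 M2} f"
    using lip by blast
  have L0: "L \<ge> 0" using lipschitz_on_nonneg[OF L] .
  have fL: "\<bar>f (w r) - f (v r)\<bar> \<le> L * \<bar>w r - v r\<bar>" if "r \<in> {0..R}" for r
  proof -
    have "w r \<in> {- max M1 M2..max M1 M2}" "v r \<in> {- max M1 M2..max M1 M2}"
      using M1[OF that] M2[OF that] by (auto simp: abs_le_iff)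
    then show ?thesis
      using lipschitz_onD[OF L] by (simp add: dist_real_def)
  qed
  \<comment> \<open>The singular term \<open>(d - 1) v'/r\<close> only damps \<open>Q\<close>, so \<open>Q' \<le> (L + 1) Q\<close> although the equation degenerates at \<open>0\<close>.\<close>
  define Q where "Q r = (w r - v r)\<^sup>2 + (w' r - v' r)\<^sup>2" for r
  have QR: "Q R * exp (- (L + 1) * R) \<le> Q 0 * exp (- (L + 1) * 0)"
  proof (rule DERIV_nonpos_imp_decreasing_open[where f="\<lambda>r. Q r * exp (- (L + 1) * r)"])
    show "continuous_on {0..R} (\<lambda>r. Q r * exp (- (L + 1) * r))"
      unfolding Q_def using con' by (intro continuous_intros)
    fix r assume r: "0 < r" "r < R"
    let ?z = "w r - v r" and ?y = "w' r - v' r"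
    let ?n = "real (d - 1)"
    let ?D = "2 * ?z * ?y + 2 * ?y * (- (f (w r) - f (v r)) - ?n * ?y / r)"
    have dz: "((\<lambda>r. w r - v r) has_real_derivative ?y) (at r)"
      using r by (intro DERIV_diff v' w')
    have dy: "((\<lambda>r. w' r - v' r) has_real_derivative
        (- f (w r) - ?n * w' r / r) - (- f (v r) - ?n * v' r / r)) (at r)"
      using r by (intro DERIV_diff v' w')
    have "(Q has_real_derivative ?D) (at r)"
      unfolding Q_def[abs_def]
      using DERIV_add[OF DERIV_power[OF dz, of 2] DERIV_power[OF dy, of 2]]
      by (simp add: algebra_simps diff_divide_distrib)
    moreover have "((\<lambda>r. exp (- (L + 1) * r)) has_real_derivative exp (- (L + 1) * r) * - (L + 1)) (at r)"
      by (auto intro!: derivative_eq_intros)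
    ultimately have "((\<lambda>r. Q r * exp (- (L + 1) * r)) has_real_derivative
        ?D * exp (- (L + 1) * r) + exp (- (L + 1) * r) * - (L + 1) * Q r) (at r)"
      by (rule DERIV_mult)
    moreover have "?D \<le> (L + 1) * Q r"
    proof -
      have "2 * ?z * ?y \<le> Q r"
        unfolding Q_def by (rule sum_squares_bound)
      moreover have "2 * ?y * - (f (w r) - f (v r)) \<le> L * Q r"
      proof -
        have "2 * ?y * - (f (w r) - f (v r)) \<le> \<bar>2 * ?y * - (f (w r) - f (v r))\<bar>"
          by (rule abs_ge_self)
        also have "\<dots> = 2 * \<bar>?y\<bar> * \<bar>f (w r) - f (v r)\<bar>"
          by (simp only: abs_mult abs_minus_cancel abs_numeral)
        also have "\<dots> \<le> 2 * \<bar>?y\<bar> * (L * \<bar>?z\<bar>)"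
          using fL[of r] r by (intro mult_left_mono) auto
        also have "\<dots> = L * (2 * \<bar>?z\<bar> * \<bar>?y\<bar>)"
          by simp
        also have "\<dots> \<le> L * Q r"
          using sum_squares_bound[of "\<bar>?z\<bar>" "\<bar>?y\<bar>"] L0 unfolding Q_def
          by (intro mult_left_mono) auto
        finally show ?thesis .
      qed
      moreover have "2 * ?n * ?y\<^sup>2 / r \<ge> 0"
        using r by simp
      moreover have "2 * z * y + 2 * y * (- e - n * y / r) = 2 * z * y + 2 * y * - e - 2 * n * y\<^sup>2 / r"
        for z y e n :: real
        by (simp add: power2_eq_square algebra_simps)
      ultimately show ?thesis
        by (simp only: distrib_right mult_1_left)
    qed
    then have "?D * exp (- (L + 1) * r) + exp (- (L + 1) * r) * - (L + 1) * Q r \<le> 0"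
    proof -
      have "D * e + e * - (L + 1) * q \<le> 0" if "D \<le> (L + 1) * q" "e \<ge> 0" for D e q :: real
        using mult_right_mono[OF that] by (simp add: algebra_simps)
      then show ?thesis
        using \<open>?D \<le> (L + 1) * Q r\<close> exp_ge_zero by blast
    qed
    ultimately show "\<exists>y. ((\<lambda>r. Q r * exp (- (L + 1) * r)) has_real_derivative y) (at r) \<and> y \<le> 0"
      by blast
  qed (use assms in auto)
  have "Q 0 = 0" using v' w' by (simp add: Q_def)
  then have "Q R \<le> 0"
    using QR by (simp add: mult_le_0_iff not_le)
  then show ?thesis
    by (simp add: Q_def sum_power2_le_zero_iff)
qed

text \<open>With \<open>G\<close> an antiderivative of \<open>g\<close>, the damping makes the
  energy \<open>v'^2 / 2 + G v\<close> nonincreasing. It starts at \<open>G l\<close>, while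
  \<open>G\<close> increases strictly above \<open>l\<close>, so \<open>v\<close> cannot get
  there.\<close>

lemma radial_solution_le_initial:
  assumes sol: "radial_solution d g l v"
    and g: "continuous_on UNIV g" "\<And>s. s > l \<Longrightarrow> g s > 0"
    and "R \<ge> 0"
  shows "v R \<le> l"
proof (rule ccontr)
  assume "\<not> v R \<le> l"
  then have vR: "l < v R" by simp
  obtain v' where v':
    "\<And>r. r > 0 \<Longrightarrow> (v has_real_derivative v' r) (at r)"
    "\<And>r. r > 0 \<Longrightarrow> (v' has_real_derivative - g (v r) - real (d - 1) * v' r / r) (at r)"
    "continuous_on {0..} v" "continuous_on {0..} v'" "v 0 = l" "v' 0 = 0"
    using sol by (rule radial_solutionE) blast
  obtain G where G: "\<And>s. (G has_real_derivative g s) (at s)"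
    using einterval_antiderivative[of "-\<infinity>" "\<infinity>" g] g(1)
    by (auto simp: has_real_derivative_iff_has_vector_derivative continuous_on_eq_continuous_at)
  have conG: "continuous_on S G" for S
    by (meson G DERIV_isCont continuous_at_imp_continuous_on)
  have con': "continuous_on {0..R} v" "continuous_on {0..R} v'"
    using v' by (auto elim: continuous_on_subset)
  have "(v' R)\<^sup>2 / 2 + G (v R) \<le> (v' 0)\<^sup>2 / 2 + G (v 0)"
  proof (rule DERIV_nonpos_imp_decreasing_open[where f="\<lambda>r. (v' r)\<^sup>2 / 2 + G (v r)"])
    show "continuous_on {0..R} (\<lambda>r. (v' r)\<^sup>2 / 2 + G (v r))"
      using con' by (intro continuous_intros continuous_on_compose2[OF conG[of UNIV]]) auto
    fix r assume r: "0 < r" "r < R"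
    let ?n = "real (d - 1)"
    have "((\<lambda>r. (v' r)\<^sup>2 / 2 + G (v r)) has_real_derivative - ?n * (v' r)\<^sup>2 / r) (at r)"
      by (rule DERIV_cong[OF DERIV_add[OF DERIV_cdivide[OF DERIV_power[OF v'(2)[OF r(1)], of 2], of 2]
              DERIV_chain'[OF v'(1)[OF r(1)] G]]])
        (use r in \<open>simp add: field_simps power2_eq_square\<close>)
    then show "\<exists>y. ((\<lambda>r. (v' r)\<^sup>2 / 2 + G (v r)) has_real_derivative y) (at r) \<and> y \<le> 0"
      using r by (intro exI conjI) auto
  qed (use \<open>R \<ge> 0\<close> in auto)
  then have "G (v R) \<le> G l"
    using zero_le_power2[of "v' R"] unfolding v'(5,6) by (simp only: zero_power2)
  moreover have "G l < G (v R)"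
    using g(2) G conG by (intro DERIV_pos_imp_increasing_open[OF vR]) auto
  ultimately show False by simp
qed

text \<open>Pohozaev argument at the first zero \<open>T\<close>: the function \<open>P\<close>
  decreases strictly from \<open>0\<close>, yet \<open>P T\<close> reduces to
  \<open>T ^ d * (v' T)^2 / 2\<close>. The bound \<open>le\<close> keeps \<open>v\<close> in the
  range where \<open>F\<close> and \<open>ineq\<close> are available.\<close>

lemma radial_solution_pos:
  assumes sol: "radial_solution d g l v" and d: "d \<ge> 2" and l: "l > 0"
    and le: "\<And>r. r \<ge> 0 \<Longrightarrow> v r \<le> l"
    and F: "\<And>s. s \<in> {0..l} \<Longrightarrow> (F has_real_derivative g s) (at s)" "F 0 = 0"
    and ineq: "\<And>s. 0 < s \<Longrightarrow> s \<le> l \<Longrightarrow> 2 * real d * F s < (real d - 2) * (s * g s)"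
    and "R \<ge> 0"
  shows "v R > 0"
proof (rule ccontr)
  assume "\<not> v R > 0"
  obtain v' where v':
    "\<And>r. r > 0 \<Longrightarrow> (v has_real_derivative v' r) (at r)"
    "\<And>r. r > 0 \<Longrightarrow> (v' has_real_derivative - g (v r) - real (d - 1) * v' r / r) (at r)"
    "continuous_on {0..} v" "continuous_on {0..} v'" "v 0 = l" "v' 0 = 0"
    using sol by (rule radial_solutionE) blast
  define Z where "Z = {0..R} \<inter> v -` {..0}"
  have "closed Z"
    unfolding Z_def using v'(3) by (intro continuous_closed_preimage) (auto elim: continuous_on_subset)
  moreover have "R \<in> Z" "bdd_below Z"
    using \<open>R \<ge> 0\<close> \<open>\<not> v R > 0\<close> by (auto simp: Z_def)
  ultimately have "Inf Z \<in> Z" by (metis closed_contains_Inf empty_iff)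
  define T where "T = Inf Z"
  have T: "T \<ge> 0" "v T \<le> 0" using \<open>Inf Z \<in> Z\<close> by (auto simp: T_def Z_def)
  then have T0: "T > 0" using v' l by (cases "T = 0") auto
  have pos: "v r > 0" if "0 \<le> r" "r < T" for r
  proof (rule ccontr)
    assume "\<not> v r > 0"
    then have "r \<in> Z" using that \<open>Inf Z \<in> Z\<close> by (auto simp: Z_def T_def)
    then show False using that cInf_lower[OF _ \<open>bdd_below Z\<close>] by (fastforce simp: T_def)
  qed
  \<comment> \<open>Membership of \<open>T\<close> in \<open>Z\<close> gives only
    \<open>v T \<le> 0\<close>; the other inequality is the limit from the left of positive
    values.\<close>
  have vT: "v T = 0"
  proof (rule antisym)
    have "(v \<longlongrightarrow> v T) (at T within {0..})"
      using v'(3) T by (auto simp: continuous_on_def)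
    then have "(v \<longlongrightarrow> v T) (at T within {0..<T})"
      by (rule tendsto_within_subset) auto
    moreover have "eventually (\<lambda>r. v r \<ge> 0) (at T within {0..<T})"
      using pos by (auto simp: eventually_at_filter intro!: always_eventually less_imp_le)
    moreover have "at T within {0..<T} \<noteq> bot"
      using T0 by (simp add: at_within_eq_bot_iff trivial_limit_within islimpt_greaterThanLessThan2)
    ultimately show "v T \<ge> 0" by (metis tendsto_lowerbound)
  qed (fact T)
  have con': "continuous_on {0..T} v" "continuous_on {0..T} v'"
    using v' by (auto elim: continuous_on_subset)
  have vin: "v ` {0..T} \<subseteq> {0..l}"
    using le pos vT by (force simp: le_less)
  have conF: "continuous_on {0..l} F"
    by (meson F(1) DERIV_isCont continuous_at_imp_continuous_on)
  define P where "P r = r ^ d * ((v' r)\<^sup>2 / 2 + F (v r)) + (real d - 2) / 2 * (r ^ (d - 1) * (v r * v' r))" for r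
  have "P T < P 0"
  proof (rule DERIV_neg_imp_decreasing_open[OF T0])
    show "continuous_on {0..T} P"
      unfolding P_def using con' vin by (intro continuous_intros continuous_on_compose2[OF conF]) auto
    fix r assume r: "0 < r" "r < T"
    have vr: "0 < v r" "v r \<le> l" using pos[of r] le[of r] r by auto
    let ?n = "real (d - 1)"
    \<comment> \<open>With \<open>d = Suc (Suc m)\<close> the exponents \<open>d - 1\<close> and
      \<open>d - 1 - 1\<close> simplify without truncated subtraction.\<close>
    define m where "m = d - 2"
    then have m: "d = Suc (Suc m)" using d by simp
    have dF: "((\<lambda>r. F (v r)) has_real_derivative g (v r) * v' r) (at r)"
      using DERIV_chain'[OF v'(1)[OF r(1)] F(1)] vr by (simp add: mult.commute)
    have "((\<lambda>r. (v' r)\<^sup>2 / 2 + F (v r)) has_real_derivative - ?n * (v' r)\<^sup>2 / r) (at r)"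
      by (rule DERIV_cong[OF DERIV_add[OF DERIV_cdivide[OF DERIV_power[OF v'(2)[OF r(1)], of 2], of 2] dF]])
        (use r in \<open>simp add: field_simps power2_eq_square\<close>)
    note A = DERIV_mult[OF DERIV_power[OF DERIV_ident, of d] this]
    note B = DERIV_cmult[OF DERIV_mult[OF DERIV_power[OF DERIV_ident, of "d - 1"]
        DERIV_mult[OF v'(1)[OF r(1)] v'(2)[OF r(1)]]], of "(real d - 2) / 2"]
    \<comment> \<open>The factor \<open>(d - 2) / 2\<close> in \<open>P\<close> is the one that
      cancels the \<open>v'^2\<close> terms, since \<open>d / 2 - (d - 1) + (d - 2) / 2 = 0\<close>;
      the \<open>v v'\<close> terms cancel each other.\<close>
    have "(P has_real_derivative r ^ (d - 1) * (2 * real d * F (v r) - (real d - 2) * (v r * g (v r))) / 2) (at r)"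
      unfolding P_def[abs_def]
      by (rule DERIV_cong[OF DERIV_add[OF A B]])
        (use r in \<open>simp add: m field_simps power2_eq_square\<close>)
    moreover have "r ^ (d - 1) * (2 * real d * F (v r) - (real d - 2) * (v r * g (v r))) / 2 < 0"
      using ineq[OF vr] r by (simp add: mult_less_0_iff)
    ultimately show "\<exists>y. (P has_real_derivative y) (at r) \<and> y < 0" by blast
  qed
  moreover have "P 0 = 0" using d v' by (simp add: P_def)
  moreover have "P T \<ge> 0" using T0 by (simp add: P_def vT F)
  ultimately show False by simp
qed

subsection \<open>Existence for bounded Lipschitz nonlinearities\<close>

lemma DERIV_integral_halfline:
  fixes h :: "real \<Rightarrow> real"
  assumes "continuous_on {0..} h" "t \<ge> 0"
  shows "((\<lambda>u. integral {0..u} h) has_real_derivative h t) (at t within {0..})"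
proof -
  have "((\<lambda>u. integral {0..u} h) has_real_derivative h t) (at t within {0..t + 1})"
    using assms by (intro integral_has_real_derivative) (auto elim: continuous_on_subset)
  moreover have "at t within {0..t + 1} = at t within {0..}"
    by (rule at_within_nhd[of _ "{..<t + 1}"]) auto
  ultimately show ?thesis by simp
qed

lemma continuous_on_integral_halfline:
  fixes h :: "real \<Rightarrow> real"
  assumes "continuous_on {0..} h"
  shows "continuous_on {0..} (\<lambda>u. integral {0..u} h)"
  using DERIV_continuous_on[of "{0..}" "\<lambda>u. integral {0..u} h" h] DERIV_integral_halfline[OF assms]
  by simp

text \<open>One integration gains a factor \<open>1 / K\<close> against the weight
  \<open>exp (K * t)\<close>; this gain drives the contraction.\<close>

lemma integral_exp_bound:
  fixes h :: "real \<Rightarrow> real"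
  assumes h: "continuous_on {0..} h" and K: "K > 0" and D: "D \<ge> 0" and s: "s \<ge> 0"
    and le: "\<And>t. t \<ge> 0 \<Longrightarrow> \<bar>h t\<bar> \<le> D * exp (K * t)"
  shows "\<bar>integral {0..s} h\<bar> \<le> D / K * exp (K * s)"
proof -
  have "((\<lambda>t. D * exp (K * t)) has_integral D / K * exp (K * s) - D / K * exp (K * 0)) {0..s}"
    using K s by (intro fundamental_theorem_of_calculus)
      (auto intro!: derivative_eq_intros simp: has_real_derivative_iff_has_vector_derivative[symmetric])
  moreover have "h integrable_on {0..s}"
    using h by (intro integrable_continuous_real) (auto elim: continuous_on_subset)
  ultimately have "norm (integral {0..s} h) \<le> D / K * exp (K * s) - D / K * exp (K * 0)"
    using le by (metis atLeastAtMost_iff has_integral_integrable_integral integral_norm_bound_integral real_norm_def)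
  moreover have "D / K \<ge> 0" using K D by simp
  ultimately show ?thesis by simp
qed

section \<open>Integral operator of the radial equation\<close>

text \<open>This is \<open>u'\<close> for the solution of \<open>(r^n u')' = r^n h\<close> with
  \<open>u'(0) = 0\<close>.\<close>

definition radial_flux :: "nat \<Rightarrow> (real \<Rightarrow> real) \<Rightarrow> real \<Rightarrow> real" where
  "radial_flux n h s = (if s \<le> 0 then 0 else integral {0..s} (\<lambda>t. t ^ n * h t) / s ^ n)"

text \<open>On the domain of integration \<open>t ^ n / s ^ n \<le> 1\<close>, so the singular
  weight drops out of the estimate.\<close>

lemma radial_flux_le:
  assumes h: "continuous_on {0..} h" and s: "s \<ge> 0"
  shows "\<bar>radial_flux n h s\<bar> \<le> integral {0..s} (\<lambda>t. \<bar>h t\<bar>)"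
proof (cases "s = 0")
  case False
  then have s: "s > 0" using s by simp
  have h': "continuous_on {0..s} h"
    using h by (rule continuous_on_subset) auto
  have "norm (integral {0..s} (\<lambda>t. t ^ n * h t)) \<le> integral {0..s} (\<lambda>t. s ^ n * \<bar>h t\<bar>)"
    using h' by (intro integral_norm_bound_integral integrable_continuous_real continuous_intros)
      (auto simp: abs_mult power_abs intro!: mult_right_mono power_mono)
  then have "\<bar>integral {0..s} (\<lambda>t. t ^ n * h t)\<bar> \<le> s ^ n * integral {0..s} (\<lambda>t. \<bar>h t\<bar>)"
    by simp
  then show ?thesis
    using s by (simp add: radial_flux_def abs_div_pos[symmetric] divide_le_eq mult.commute)
qed (simp add: radial_flux_def)

text \<open>Away from \<open>0\<close> this is a quotient of continuous functions; at
  \<open>0\<close> the weight-free bound \<open>radial_flux_le\<close> forces the limit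
  \<open>0\<close>.\<close>

lemma continuous_on_radial_flux:
  assumes h: "continuous_on {0..} h"
  shows "continuous_on {0..} (radial_flux n h)"
proof -
  have 1: "(radial_flux n h \<longlongrightarrow> radial_flux n h s) (at s within {0..})" if s: "s > 0" for s
  proof -
    have "continuous_on {0<..} (\<lambda>s. integral {0..s} (\<lambda>t. t ^ n * h t) / s ^ n)"
      using h by (intro continuous_intros continuous_on_subset[OF continuous_on_integral_halfline]) auto
    then have "continuous_on {0<..} (radial_flux n h)"
      by (rule continuous_on_eq) (auto simp: radial_flux_def)
    then have "isCont (radial_flux n h) s"
      using s by (simp add: continuous_on_eq_continuous_at)
    then show ?thesis
      by (simp add: isCont_def Lim_at_imp_Lim_at_within)
  qed
  have 2: "(radial_flux n h \<longlongrightarrow> 0) (at 0 within {0..})"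
  proof (rule Lim_null_comparison)
    have "continuous_on {0..} (\<lambda>s. integral {0..s} (\<lambda>t. \<bar>h t\<bar>))"
      using h by (intro continuous_on_integral_halfline continuous_intros)
    then show "((\<lambda>s. integral {0..s} (\<lambda>t. \<bar>h t\<bar>)) \<longlongrightarrow> 0) (at 0 within {0..})"
      by (force simp: continuous_on_def)
    show "\<forall>\<^sub>F s in at 0 within {0..}. norm (radial_flux n h s) \<le> integral {0..s} (\<lambda>t. \<bar>h t\<bar>)"
      using radial_flux_le[OF h] by (auto simp: eventually_at_filter)
  qed
  have "radial_flux n h 0 = 0"
    by (simp add: radial_flux_def)
  then show ?thesis
    unfolding continuous_on_def using 1 2 by (metis atLeast_iff le_less)
qed

text \<open>The corresponding \<open>u\<close> with \<open>u(0) = 0\<close>. The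
  \<open>max 0 r\<close> extends it by \<open>0\<close> to negative \<open>r\<close>, so that it is
  a continuous function on the whole line, as the type of bounded continuous functions
  requires.\<close>

definition radial_potential :: "nat \<Rightarrow> (real \<Rightarrow> real) \<Rightarrow> real \<Rightarrow> real" where
  "radial_potential n h r = integral {0..max 0 r} (radial_flux n h)"

lemma continuous_on_radial_potential:
  assumes h: "continuous_on {0..} h"
  shows "continuous_on S (radial_potential n h)"
  unfolding radial_potential_def[abs_def]
  by (rule continuous_on_compose2[OF continuous_on_integral_halfline[OF continuous_on_radial_flux[OF h]]])
    (auto intro!: continuous_intros)

text \<open>Flux and potential are two successive integrations, each gaining \<open>1 / K\<close> by
  \<open>integral_exp_bound\<close>.\<close>

lemma radial_potential_bound:
  assumes h: "continuous_on {0..} h" and K: "K > 0" and D: "D \<ge> 0"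
    and le: "\<And>t. t \<ge> 0 \<Longrightarrow> \<bar>h t\<bar> \<le> D * exp (K * t)"
  shows "\<bar>radial_potential n h r\<bar> \<le> D / K\<^sup>2 * exp (K * max 0 r)"
proof -
  have "\<bar>radial_flux n h s\<bar> \<le> D / K * exp (K * s)" if s: "s \<ge> 0" for s
  proof -
    have "\<bar>integral {0..s} (\<lambda>t. \<bar>h t\<bar>)\<bar> \<le> D / K * exp (K * s)"
      using h le by (intro integral_exp_bound K D s continuous_intros) auto
    then show ?thesis
      using radial_flux_le[OF h s, of n] by linarith
  qed
  then have "\<bar>radial_potential n h r\<bar> \<le> D / K / K * exp (K * max 0 r)"
    unfolding radial_potential_def
    using K D by (intro integral_exp_bound continuous_on_radial_flux h) auto
  then show ?thesis
    by (simp add: power2_eq_square)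
qed

lemma radial_potential_diff:
  assumes h: "continuous_on {0..} h1" "continuous_on {0..} h2"
  shows "radial_potential n h1 r - radial_potential n h2 r = radial_potential n (\<lambda>t. h1 t - h2 t) r"
proof -
  have sub: "continuous_on {0..s} h1" "continuous_on {0..s} h2" for s
    using h by (auto elim: continuous_on_subset)
  have "integral {0..s} (\<lambda>t. t ^ n * h1 t - t ^ n * h2 t)
      = integral {0..s} (\<lambda>t. t ^ n * h1 t) - integral {0..s} (\<lambda>t. t ^ n * h2 t)" for s
    using sub by (intro integral_diff integrable_continuous_real continuous_intros)
  then have "radial_flux n (\<lambda>t. h1 t - h2 t) = (\<lambda>s. radial_flux n h1 s - radial_flux n h2 s)"
    by (simp add: fun_eq_iff radial_flux_def right_diff_distrib diff_divide_distrib)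
  moreover have "radial_flux n h1 integrable_on {0..s}" "radial_flux n h2 integrable_on {0..s}" for s
    using h[THEN continuous_on_radial_flux, THEN continuous_on_subset]
    by (auto intro!: integrable_continuous_real)
  ultimately show ?thesis
    by (simp add: radial_potential_def integral_diff)
qed

text \<open>Banach's theorem in an exponentially weighted sup norm yields a solution on the whole
  half-line at once, with no continuation of local solutions. The bound \<open>M\<close> keeps the
  iteration map inside the space, and \<open>L\<close> gives the contraction.\<close>

lemma radial_potential_fixpoint:
  fixes g :: "real \<Rightarrow> real"
  assumes lip: "L-lipschitz_on UNIV g" and bdd: "\<And>s. \<bar>g s\<bar> \<le> M"
  shows "\<exists>v. continuous_on {0..} v \<and> (\<forall>r\<ge>0. v r = l - radial_potential n (\<lambda>t. g (v t)) r)"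
proof -
  have L0: "L \<ge> 0" using lipschitz_on_nonneg[OF lip] .
  have M0: "M \<ge> 0" using bdd[of 0] by linarith
  have cg: "continuous_on UNIV g" using lipschitz_on_continuous_on[OF lip] .
  \<comment> \<open>Two integrations give the contraction factor \<open>L / K^2\<close>; this
    \<open>K\<close> makes it less than \<open>1\<close>, because
    \<open>L < (L + 1)^2\<close>.\<close>
  define K where "K = L + 1"
  have K: "K > 0" using L0 by (simp add: K_def)
  have "L < K\<^sup>2"
    using L0 by (simp add: K_def power2_eq_square algebra_simps add_pos_nonneg)
  then have contr: "L / K\<^sup>2 < 1"
    using K by simp
  \<comment> \<open>The unknown is \<open>\<phi>(r) = exp(- K r) (v(r) - l)\<close>, which is bounded since \<open>g\<close> is.\<close>
  define h where "h \<phi> t = g (l + exp (K * t) * apply_bcontfun \<phi> t)" for \<phi> :: "real \<Rightarrow>\<^sub>C real" and t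
  have ch: "continuous_on {0..} (h \<phi>)" for \<phi>
    unfolding h_def[abs_def]
    by (intro continuous_on_compose2[OF cg] continuous_intros) auto
  define U where "U \<phi> r = - (exp (- (K * max 0 r)) * radial_potential n (h \<phi>) r)" for \<phi> r
  define \<Phi> where "\<Phi> \<phi> = Bcontfun (U \<phi>)" for \<phi>
  have U: "apply_bcontfun (\<Phi> \<phi>) = U \<phi>" for \<phi>
    unfolding \<Phi>_def
  proof (rule Bcontfun_inverse, rule bcontfun_normI)
    show "continuous_on UNIV (U \<phi>)"
      unfolding U_def[abs_def] by (intro continuous_intros continuous_on_radial_potential ch)
    show "norm (U \<phi> r) \<le> M / K\<^sup>2" for r
    proof -
      have "\<bar>h \<phi> t\<bar> \<le> M * exp (K * t)" if "t \<ge> 0" for t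
      proof -
        have "M * 1 \<le> M * exp (K * t)"
          using M0 K that by (intro mult_left_mono) auto
        then show ?thesis using bdd unfolding h_def by (metis mult.right_neutral order_trans)
      qed
      then have "\<bar>radial_potential n (h \<phi>) r\<bar> \<le> M / K\<^sup>2 * exp (K * max 0 r)"
        by (rule radial_potential_bound[OF ch K M0])
      then have "exp (- (K * max 0 r)) * \<bar>radial_potential n (h \<phi>) r\<bar>
          \<le> exp (- (K * max 0 r)) * (M / K\<^sup>2 * exp (K * max 0 r))"
        by (rule mult_left_mono) simp
      also have "\<dots> = M / K\<^sup>2 * (exp (K * max 0 r) * exp (- (K * max 0 r)))"
        by (simp only: mult_ac)
      also have "\<dots> = M / K\<^sup>2"
        by (simp only: exp_minus_inverse mult_1_right)
      finally show ?thesis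
        by (simp add: U_def abs_mult)
    qed
  qed
  have "\<exists>!\<phi>. \<Phi> \<phi> = \<phi>"
  proof (rule banach_fix_type)
    show "0 \<le> L / K\<^sup>2" using L0 by simp
    show "\<forall>\<phi> \<psi>. dist (\<Phi> \<phi>) (\<Phi> \<psi>) \<le> L / K\<^sup>2 * dist \<phi> \<psi>"
    proof (intro allI dist_bound)
      fix \<phi> \<psi> r
      have "\<bar>h \<phi> t - h \<psi> t\<bar> \<le> L * dist \<phi> \<psi> * exp (K * t)" for t
      proof -
        have "\<bar>h \<phi> t - h \<psi> t\<bar> \<le> L * (exp (K * t) * dist (apply_bcontfun \<phi> t) (apply_bcontfun \<psi> t))"
          using lipschitz_onD[OF lip, of "l + exp (K * t) * apply_bcontfun \<phi> t" "l + exp (K * t) * apply_bcontfun \<psi> t"]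
          by (simp add: h_def dist_real_def abs_mult flip: right_diff_distrib)
        also have "\<dots> \<le> L * (exp (K * t) * dist \<phi> \<psi>)"
          using L0 by (intro mult_left_mono dist_bounded) auto
        finally show ?thesis by (simp add: mult_ac)
      qed
      then have "\<bar>radial_potential n (\<lambda>t. h \<phi> t - h \<psi> t) r\<bar> \<le> L * dist \<phi> \<psi> / K\<^sup>2 * exp (K * max 0 r)"
        using L0 by (intro radial_potential_bound K continuous_intros ch) auto
      then have "\<bar>radial_potential n (h \<phi>) r - radial_potential n (h \<psi>) r\<bar> \<le> L * dist \<phi> \<psi> / K\<^sup>2 * exp (K * max 0 r)"
        by (simp add: radial_potential_diff ch)
      moreover have "dist (U \<phi> r) (U \<psi> r) = exp (- (K * max 0 r)) * \<bar>radial_potential n (h \<phi>) r - radial_potential n (h \<psi>) r\<bar>"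
        by (simp add: U_def dist_real_def abs_mult abs_minus_commute flip: right_diff_distrib)
      ultimately have "dist (U \<phi> r) (U \<psi> r) \<le> exp (- (K * max 0 r)) * (L * dist \<phi> \<psi> / K\<^sup>2 * exp (K * max 0 r))"
        by (simp only: mult_left_mono exp_ge_zero)
      also have "\<dots> = L / K\<^sup>2 * dist \<phi> \<psi> * (exp (K * max 0 r) * exp (- (K * max 0 r)))"
        by (simp only: mult_ac times_divide_eq_left times_divide_eq_right)
      also have "\<dots> = L / K\<^sup>2 * dist \<phi> \<psi>"
        by (simp only: exp_minus_inverse mult_1_right)
      finally show "dist (apply_bcontfun (\<Phi> \<phi>) r) (apply_bcontfun (\<Phi> \<psi>) r) \<le> L / K\<^sup>2 * dist \<phi> \<psi>"
        by (simp only: U)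
    qed
  qed (fact contr)
  then obtain \<phi> where \<phi>: "\<Phi> \<phi> = \<phi>" by blast
  define v where "v r = l + exp (K * r) * apply_bcontfun \<phi> r" for r
  have "h \<phi> = (\<lambda>t. g (v t))"
    by (simp add: h_def v_def fun_eq_iff)
  then have \<phi>_eq: "apply_bcontfun \<phi> r = - (exp (- (K * max 0 r)) * radial_potential n (\<lambda>t. g (v t)) r)" for r
    using U[of \<phi>] by (simp add: \<phi> U_def)
  have "v r = l - radial_potential n (\<lambda>t. g (v t)) r" if "r \<ge> 0" for r
  proof -
    have "v r = l + exp (K * r) * apply_bcontfun \<phi> r"
      by (simp only: v_def)
    also have "\<dots> = l - (exp (K * r) * exp (- (K * r))) * radial_potential n (\<lambda>t. g (v t)) r"
      unfolding \<phi>_eq using that by (simp add: max_absorb2)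
    also have "\<dots> = l - radial_potential n (\<lambda>t. g (v t)) r"
      by (simp only: exp_minus_inverse mult_1_left)
    finally show ?thesis .
  qed
  moreover have "continuous_on {0..} v"
    unfolding v_def[abs_def] by (intro continuous_intros) auto
  ultimately show ?thesis by blast
qed

text \<open>The fixed point is differentiated: \<open>v'\<close> is minus the flux, and
  \<open>r ^ (d - 1) * v' r\<close> is minus a plain integral, so the fundamental theorem of
  calculus gives the equation.\<close>

lemma radial_solution_exists:
  fixes g :: "real \<Rightarrow> real"
  assumes lip: "L-lipschitz_on UNIV g" and bdd: "\<And>s. \<bar>g s\<bar> \<le> M"
  shows "\<exists>v. radial_solution d g l v"
proof -
  let ?n = "d - 1"
  obtain v where cv: "continuous_on {0..} v"
    and v: "\<And>r. r \<ge> 0 \<Longrightarrow> v r = l - radial_potential ?n (\<lambda>t. g (v t)) r"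
    using radial_potential_fixpoint[OF assms, where l=l and n="?n"] by blast
  let ?h = "\<lambda>t. g (v t)"
  have ch: "continuous_on {0..} ?h"
    using lipschitz_on_continuous_on[OF lip] cv by (rule continuous_on_compose2) auto
  define v' where "v' r = - radial_flux ?n ?h r" for r
  define w' where "w' r = - (r ^ ?n * g (v r))" for r
  have "(v has_real_derivative v' r) (at r within {0..})" if r: "r \<ge> 0" for r
  proof -
    have "((\<lambda>r. l - integral {0..r} (radial_flux ?n ?h)) has_real_derivative 0 - radial_flux ?n ?h r) (at r within {0..})"
      using r by (intro DERIV_diff DERIV_const DERIV_integral_halfline continuous_on_radial_flux ch)
    then have "((\<lambda>r. l - integral {0..r} (radial_flux ?n ?h)) has_real_derivative v' r) (at r within {0..})"
      by (simp add: v'_def)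
    then show ?thesis
      by (rule has_field_derivative_transform_within[where d=1])
        (use r v in \<open>auto simp: radial_potential_def\<close>)
  qed
  moreover have "continuous_on {0..} v'"
    unfolding v'_def[abs_def] by (intro continuous_intros continuous_on_radial_flux ch)
  moreover have "((\<lambda>r. r ^ ?n * v' r) has_real_derivative w' r) (at r)" if r: "r > 0" for r
  proof -
    have "((\<lambda>u. integral {0..u} (\<lambda>t. t ^ ?n * ?h t)) has_real_derivative r ^ ?n * ?h r) (at r within {0..})"
      using r by (intro DERIV_integral_halfline continuous_intros ch) auto
    moreover have "at r within {0..} = at r"
      using r by (intro at_within_interior) auto
    ultimately have "((\<lambda>u. - integral {0..u} (\<lambda>t. t ^ ?n * ?h t)) has_real_derivative w' r) (at r)"
      unfolding w'_def by (metis DERIV_minus)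
    moreover have "eventually (\<lambda>r. r ^ ?n * v' r = - integral {0..r} (\<lambda>t. t ^ ?n * ?h t)) (nhds r)"
      by (rule eventually_mono[OF eventually_nhds_in_open[of "{0<..}" r]])
        (use r in \<open>auto simp: v'_def radial_flux_def\<close>)
    ultimately show ?thesis
      by (subst DERIV_cong_ev[OF refl _ refl])
  qed
  moreover have "continuous_on {0<..} w'"
    unfolding w'_def[abs_def] by (intro continuous_intros continuous_on_subset[OF ch]) auto
  moreover have "v 0 = l" "v' 0 = 0"
    using v[of 0] by (auto simp: radial_potential_def v'_def radial_flux_def)
  moreover have "\<forall>r>0. w' r + r ^ (d - 1) * g (v r) = 0"
    by (simp add: w'_def)
  ultimately show ?thesis
    unfolding radial_solution_def by blast
qed

subsection \<open>The nonlinearity\<close>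

text \<open>Freezing \<open>g\<close> beyond \<open>q\<close> creates no corner because
  \<open>g'\<close> vanishes at \<open>q\<close>, so both one-sided derivatives agree.\<close>

lemma DERIV_comp_min:
  fixes g g' :: "real \<Rightarrow> real"
  assumes g: "\<And>s. (g has_real_derivative g' s) (at s)" and q: "g' q = 0"
  shows "((\<lambda>s. g (min q s)) has_real_derivative g' (min q s)) (at s)"
proof -
  have "((\<lambda>s. if s \<in> {..q} then g s else g q) has_vector_derivative
      (if s \<in> {..q} then g' s else 0)) (at s within UNIV)"
  proof (rule has_vector_derivative_If_within_closures[where T="{q..}"])
    show "(g has_vector_derivative g' s) (at s within {..q} \<union> (closure {..q} \<inter> closure {q..}))"
      using g has_real_derivative_iff_has_vector_derivative has_vector_derivative_at_within by blast
    show "g' s = 0" if "s \<in> closure {..q}" "s \<in> closure {q..}"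
      using that q by (auto dest: antisym)
  qed auto
  moreover have "(\<lambda>s. if s \<in> {..q} then g s else g q) = (\<lambda>s. g (min q s))"
    by (auto simp: min_def fun_eq_iff)
  moreover have "(if s \<in> {..q} then g' s else 0) = g' (min q s)"
    using q by (auto simp: min_def)
  ultimately show ?thesis
    by (simp add: has_real_derivative_iff_has_vector_derivative)
qed

text \<open>Reflection \<open>s \<mapsto> - s\<close> of the statement for
  \<open>min\<close>.\<close>

lemma DERIV_comp_max:
  fixes g g' :: "real \<Rightarrow> real"
  assumes g: "\<And>s. (g has_real_derivative g' s) (at s)" and p: "g' p = 0"
  shows "((\<lambda>s. g (max p s)) has_real_derivative g' (max p s)) (at s)"
proof -
  have g_neg: "((\<lambda>x. g (- x)) has_real_derivative - g' (- x)) (at x)" for x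
    using DERIV_chain'[OF DERIV_minus[OF DERIV_ident] g] by simp
  have "((\<lambda>x. g (- min (- p) x)) has_real_derivative - g' (- min (- p) x)) (at x)" for x
    using DERIV_comp_min[OF g_neg, of "- p"] p by simp
  from DERIV_chain'[OF DERIV_minus[OF DERIV_ident] this]
  show ?thesis
    by (simp add: minus_min_eq_max)
qed

section \<open>Signed powers, the nonlinearity and its primitive\<close>

definition clamp1 :: "real \<Rightarrow> real" where
  "clamp1 s = max (-1) (min 1 s)"

definition spow :: "real \<Rightarrow> real \<Rightarrow> real" where
  "spow a s = \<bar>s\<bar> powr a * s"

lemma spow_minus: "spow a (- s) = - spow a s"
  by (simp add: spow_def)

text \<open>The power rule covers \<open>s > 0\<close> and oddness covers \<open>s < 0\<close>; at
  \<open>0\<close> the difference quotient is \<open>\<bar>h\<bar> powr a\<close>, which tends to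
  \<open>0\<close> since \<open>a > 0\<close>.\<close>

lemma DERIV_spow:
  assumes "a > 0"
  shows "(spow a has_real_derivative (a + 1) * \<bar>s\<bar> powr a) (at s)"
proof -
  have pos: "(spow a has_real_derivative (a + 1) * \<bar>s\<bar> powr a) (at s)" if "s > 0" for s
  proof -
    have "((\<lambda>s. s powr (a + 1)) has_real_derivative (a + 1) * s powr a) (at s)"
      using that by (auto intro!: derivative_eq_intros)
    then have "((\<lambda>s. s powr (a + 1)) has_real_derivative (a + 1) * \<bar>s\<bar> powr a) (at s)"
      using that by simp
    moreover have "eventually (\<lambda>x. spow a x = x powr (a + 1)) (nhds s)"
      using eventually_nhds_in_open[of "{0<..}" s] that
      by (auto elim!: eventually_mono simp: spow_def powr_add)
    ultimately show ?thesis
      by (subst DERIV_cong_ev[OF refl _ refl])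
  qed
  consider "s > 0" | "s = 0" | "s < 0" by linarith
  then show ?thesis
  proof cases
    case 3
    have eq: "spow a = (\<lambda>x. - spow a (- x))"
      by (simp add: spow_minus)
    have "((\<lambda>x. - spow a (- x)) has_real_derivative - (- ((a + 1) * \<bar>- s\<bar> powr a))) (at s)"
      using 3 by (intro DERIV_minus DERIV_mirror[THEN iffD1] pos) simp
    then show ?thesis
      by (subst eq) simp
  next
    case 2
    have "((\<lambda>h. \<bar>h\<bar> powr a) \<longlongrightarrow> \<bar>0\<bar> powr a) (at (0::real))"
      using assms by (intro tendsto_intros tendsto_powr') auto
    then have "((\<lambda>h. spow a h / h) \<longlongrightarrow> 0) (at (0::real))"
      by (rule Lim_transform_eventually[THEN tendsto_eq_rhs])
        (auto simp: spow_def eventually_at_filter)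
    then show ?thesis
      using 2 assms by (simp add: DERIV_def spow_def)
  qed (use pos in auto)
qed

text \<open>For \<open>a = 2 / k\<close> the constant \<open>k / (2 * (k + 1))\<close> is
  \<open>1 / (a + 2)\<close>, so this is the usual primitive
  \<open>\<bar>s\<bar>^(a + 2) / (a + 2)\<close>.\<close>

lemma DERIV_spow_times:
  assumes "k > 0"
  shows "((\<lambda>s. k / (2 * (k + 1)) * (spow (2 / k) s * s)) has_real_derivative spow (2 / k) s) (at s)"
proof -
  have "((\<lambda>s. k / (2 * (k + 1)) * (spow (2 / k) s * s)) has_real_derivative
      k / (2 * (k + 1)) * ((2 / k + 1) * \<bar>s\<bar> powr (2 / k) * s + 1 * spow (2 / k) s)) (at s)"
    using assms by (intro DERIV_cmult DERIV_mult DERIV_ident DERIV_spow) simp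
  moreover have "k / (2 * (k + 1)) * ((2 / k + 1) * \<bar>s\<bar> powr (2 / k) * s + 1 * spow (2 / k) s) = spow (2 / k) s"
    using assms by (simp add: spow_def divide_simps) (simp add: algebra_simps)
  ultimately show ?thesis
    by simp
qed

lemma continuous_on_spow: "a > 0 \<Longrightarrow> continuous_on S (spow a)"
  by (meson DERIV_spow DERIV_isCont continuous_at_imp_continuous_on)

lemma lipschitz_spow:
  assumes "a > 0"
  shows "((a + 1) * M powr a)-lipschitz_on {-M..M} (spow a)"
proof (rule bounded_derivative_imp_lipschitz)
  show "(spow a has_derivative (\<lambda>h. (a + 1) * \<bar>s\<bar> powr a * h)) (at s within {-M..M})" for s
    using DERIV_spow[OF assms, of s] by (simp add: has_field_derivative_def has_derivative_at_withinI)
  show "onorm (\<lambda>h. (a + 1) * \<bar>s\<bar> powr a * h) \<le> (a + 1) * M powr a" if "s \<in> {-M..M}" for s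
  proof (rule onorm_le)
    have "\<bar>s\<bar> powr a \<le> M powr a"
      using that assms by (intro powr_mono2) auto
    then show "norm ((a + 1) * \<bar>s\<bar> powr a * h) \<le> (a + 1) * M powr a * norm h" for h
      using assms by (auto simp: abs_mult intro!: mult_mono)
  qed
qed (use assms in auto)

lemma lipschitz_clamp1: "1-lipschitz_on X clamp1"
  by (rule lipschitz_onI) (auto simp: clamp1_def dist_real_def)

text \<open>
  The correction added to \<open>|s|^(2/k) s\<close> is continuous because \<open>spow\<close> fixes \<open>1\<close> and \<open>-1\<close>, and for the
  same reason the corresponding part of the primitive has a derivative at these points.
\<close>

definition nonlin :: "real \<Rightarrow> real \<Rightarrow> real" where
  "nonlin k s = spow (2 / k) s + k * (spow (2 / k) (clamp1 s) - clamp1 s)"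

text \<open>The coefficient \<open>k\<close> of the correction is the one that makes this vanish at
  \<open>1\<close> and \<open>-1\<close>: there it equals \<open>k / (2 * (k + 1))\<close> minus the
  coefficient times \<open>1 / (2 * (k + 1))\<close>.\<close>

definition nonlin_prim :: "real \<Rightarrow> real \<Rightarrow> real" where
  "nonlin_prim k s = k / (2 * (k + 1)) * (spow (2 / k) s * s)
     + k * (k / (2 * (k + 1)) * (spow (2 / k) (clamp1 s) * clamp1 s) - (clamp1 s)\<^sup>2 / 2)"

lemma clamp1_minus: "clamp1 (- s) = - clamp1 s"
  by (auto simp: clamp1_def)

lemma nonlin_minus: "nonlin k (- s) = - nonlin k s"
  by (simp add: nonlin_def spow_minus clamp1_minus algebra_simps)

lemma spow_clamp1:
  "\<bar>s\<bar> \<ge> 1 \<Longrightarrow> spow a (clamp1 s) = clamp1 s"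
  by (cases "s > 0") (auto simp: clamp1_def spow_def min_def max_def)

lemma nonlin_large: "\<bar>s\<bar> \<ge> 1 \<Longrightarrow> nonlin k s = spow (2 / k) s"
  by (simp add: nonlin_def spow_clamp1)

text \<open>The exponent \<open>2 / k\<close> is positive, so \<open>spow\<close> is Lipschitz
  across \<open>0\<close> as well, and \<open>clamp1\<close> confines the correction to
  \<open>{-1..1}\<close>.\<close>

lemma lipschitz_nonlin:
  assumes "k > 0"
  shows "\<exists>L. L-lipschitz_on {-M..M} (nonlin k)"
proof -
  have a: "2 / k > 0" using assms by simp
  have "clamp1 ` {-M..M} \<subseteq> {-1..1}"
    by (auto simp: clamp1_def)
  then have "((2 / k + 1) * 1 powr (2 / k))-lipschitz_on (clamp1 ` {-M..M}) (spow (2 / k))"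
    using lipschitz_on_subset[OF lipschitz_spow[OF a, of 1]] by simp
  note * = lipschitz_on_compose2[OF lipschitz_clamp1 this]
  show ?thesis
    unfolding nonlin_def[abs_def]
    by (intro exI) (rule lipschitz_intros lipschitz_on_diff lipschitz_spow[OF a] * lipschitz_clamp1)+
qed

text \<open>The unclamped correction has derivative \<open>spow (2 / k) s - s\<close>, up to the
  factor \<open>k\<close>. It vanishes at \<open>1\<close> and \<open>-1\<close>, as the clamping
  lemmas demand.\<close>

lemma DERIV_nonlin_prim:
  assumes "k > 0"
  shows "(nonlin_prim k has_real_derivative nonlin k s) (at s)"
proof -
  let ?a = "2 / k"
  let ?g = "\<lambda>s. k / (2 * (k + 1)) * (spow ?a s * s) - s\<^sup>2 / 2"
  have a: "?a > 0" using assms by simp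
  have g: "(?g has_real_derivative spow ?a s - s) (at s)" for s
    using DERIV_diff[OF DERIV_spow_times[OF assms] DERIV_cdivide[OF DERIV_power[OF DERIV_ident, of 2], of 2]]
    by simp
  have "((\<lambda>s. ?g (max (-1) (min 1 s))) has_real_derivative
      spow ?a (max (-1) (min 1 s)) - max (-1) (min 1 s)) (at s)"
    \<comment> \<open>The clamps are removed one at a time: the function already clamped below plays
      the role of \<open>g\<close> for the clamp at \<open>1\<close>.\<close>
    by (intro DERIV_comp_min[where g="\<lambda>s. ?g (max (-1) s)" and g'="\<lambda>s. spow ?a (max (-1) s) - max (-1) s"]
          DERIV_comp_max[where g="?g" and g'="\<lambda>s. spow ?a s - s"] g) (auto simp: spow_def)
  then have "((\<lambda>s. ?g (clamp1 s)) has_real_derivative spow ?a (clamp1 s) - clamp1 s) (at s)"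
    by (simp add: clamp1_def)
  from DERIV_add[OF DERIV_spow_times[OF assms] DERIV_cmult[OF this, of k]]
  show ?thesis
    unfolding nonlin_def nonlin_prim_def[abs_def] .
qed

lemma continuous_on_nonlin:
  assumes "k > 0" shows "continuous_on S (nonlin k)"
proof -
  have "continuous_on UNIV clamp1"
    using lipschitz_on_continuous_on[OF lipschitz_clamp1] .
  then have "continuous_on UNIV (nonlin k)"
    unfolding nonlin_def[abs_def]
    using assms by (intro continuous_intros continuous_on_spow continuous_on_compose2[OF continuous_on_spow[of _ UNIV]]) auto
  then show ?thesis
    using continuous_on_subset by blast
qed

lemma primitive_nonlin:
  assumes "k > 0"
  shows "primitive_from_0 (nonlin k) s = nonlin_prim k s"
proof -
  have "primitive_from_0 (nonlin k) s = nonlin_prim k s - nonlin_prim k 0"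
    unfolding primitive_from_0_def
    using DERIV_nonlin_prim[OF assms]
    by (intro interval_integral_FTC_finite continuous_on_nonlin[OF assms])
      (auto simp: has_real_derivative_iff_has_vector_derivative[symmetric] intro: has_field_derivative_at_within)
  then show ?thesis
    by (simp add: nonlin_prim_def spow_def clamp1_def)
qed

lemma nonlin_prim_small:
  assumes "k > 0" "\<bar>s\<bar> \<le> 1"
  shows "nonlin_prim k s = k / 2 * (\<bar>s\<bar> powr (2 / k) - 1) * s\<^sup>2"
proof -
  have "clamp1 s = s" using assms by (auto simp: clamp1_def)
  then show ?thesis
    using assms by (simp add: nonlin_prim_def spow_def divide_simps power2_eq_square) (simp add: algebra_simps)
qed

lemma nonlin_prim_neg:
  assumes "k > 0" "\<bar>s\<bar> < 1" "s \<noteq> 0"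
  shows "nonlin_prim k s < 0"
proof -
  have "\<bar>s\<bar> powr (2 / k) < 1 powr (2 / k)"
    using assms by (intro powr_less_mono2) auto
  then show ?thesis
    using assms by (simp add: nonlin_prim_small mult_less_0_iff)
qed

text \<open>The pure critical power gives equality here, so the gap comes from the correction alone:
  it is \<open>k * s^2\<close> up to \<open>1\<close> and the constant \<open>k\<close>
  beyond.\<close>

lemma nonlin_pohozaev:
  assumes "k > 0" "s > 0"
  shows "2 * (k + 1) * nonlin_prim k s < k * (s * nonlin k s)"
proof (cases "s \<le> 1")
  case True
  then have c: "clamp1 s = s" using assms by (auto simp: clamp1_def)
  have "k * (s * nonlin k s) - 2 * (k + 1) * nonlin_prim k s = k * s\<^sup>2"
    using assms by (simp add: nonlin_prim_def nonlin_def c divide_simps power2_eq_square) (simp add: algebra_simps)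
  moreover have "k * s\<^sup>2 > 0" using assms by simp
  ultimately show ?thesis by linarith
next
  case False
  then have c: "clamp1 s = 1" by (auto simp: clamp1_def)
  have "k * (s * nonlin k s) - 2 * (k + 1) * nonlin_prim k s = k"
    using assms by (simp add: nonlin_prim_def nonlin_def c spow_def divide_simps power2_eq_square)
  then show ?thesis using assms by linarith
qed

section \<open>Truncation and choice of the parameters\<close>

theorem proposition6p1:
  fixes d :: nat
  assumes "d \<ge> 3"
  shows "\<exists>(\<beta>::real) (f :: real \<Rightarrow> real) (\<Lambda>::real).
     \<beta> > 0 \<and>
     (\<forall>s. f (- s) = - f s) \<and>
     continuous_on UNIV f \<and>
     local_lipschitz (UNIV :: real set) (UNIV - {0}) (\<lambda>_. f) \<and>
     (\<forall>s. \<bar>s\<bar> \<ge> \<beta> \<longrightarrow> f s = \<bar>s\<bar> powr (critical_exponent d - 2) * s) \<and>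
     (\<forall>s \<in> {-\<beta><..<\<beta>} - {0}. primitive_from_0 f s < 0) \<and>
     primitive_from_0 f \<beta> = 0 \<and> primitive_from_0 f (- \<beta>) = 0 \<and>
     \<Lambda> > \<beta> \<and>
     (\<forall>l\<ge>\<Lambda>. \<exists>v. radial_solution d f l v \<and>
        (\<forall>w. radial_solution d f l w \<longrightarrow> (\<forall>r\<ge>0. w r = v r)) \<and>
        (\<forall>r\<ge>0. v r > 0))"
proof -
  define k where "k = (real d - 2) / 2"
  have k: "k > 0" using assms by (simp add: k_def)
  have crit: "critical_exponent d - 2 = 2 / k"
    using assms by (simp add: critical_exponent_def k_def field_simps)
  note lip = lipschitz_nonlin[OF k]
  \<comment> \<open>The threshold \<open>2\<close> is just a convenient number above
    \<open>\<beta> = 1\<close>.\<close>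
  have "\<exists>v. radial_solution d (nonlin k) l v \<and>
      (\<forall>w. radial_solution d (nonlin k) l w \<longrightarrow> (\<forall>r\<ge>0. w r = v r)) \<and> (\<forall>r\<ge>0. v r > 0)"
    if l: "l \<ge> 2" for l
  proof -
    \<comment> \<open>Constant continuation outside \<open>{0..l}\<close> makes \<open>g\<close>
      bounded and globally Lipschitz. Above \<open>l\<close> it keeps the value
      \<open>nonlin k l\<close>, which is positive and so prevents \<open>v\<close> from exceeding
      \<open>l\<close>.\<close>
    define g where "g s = nonlin k (max 0 (min l s))" for s
    obtain L where L: "L-lipschitz_on {-l..l} (nonlin k)"
      using lip by blast
    have "1-lipschitz_on UNIV (\<lambda>s. max 0 (min l s))"
      using l by (intro lipschitz_onI) (auto simp: dist_real_def)
    moreover have range: "range (\<lambda>s. max 0 (min l s)) \<subseteq> {-l..l}"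
      using l by auto
    ultimately have gL: "(L * 1)-lipschitz_on UNIV g"
      unfolding g_def[abs_def] by (intro lipschitz_on_compose2 lipschitz_on_subset[OF L])
    have "bounded (nonlin k ` {-l..l})"
      by (intro compact_imp_bounded compact_continuous_image continuous_on_nonlin k compact_Icc)
    then obtain M where "\<forall>x\<in>nonlin k ` {-l..l}. \<bar>x\<bar> \<le> M"
      unfolding bounded_iff real_norm_def by blast
    then have "\<bar>g s\<bar> \<le> M" for s
      using range unfolding g_def by blast
    with gL obtain v where v: "radial_solution d g l v"
      using radial_solution_exists by blast
    have gf: "g s = nonlin k s" if "s \<in> {0..l}" for s
      using that by (simp add: g_def)
    have le: "v r \<le> l" if "r \<ge> 0" for r
    proof (rule radial_solution_le_initial[OF v _ _ that])
      show "continuous_on UNIV g"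
        using lipschitz_on_continuous_on[OF gL] .
      show "g s > 0" if "s > l" for s
        using that l by (simp add: g_def nonlin_large spow_def)
    qed
    have pos: "v r > 0" if "r \<ge> 0" for r
    proof (rule radial_solution_pos[OF v _ _ le _ _ _ that, where F="nonlin_prim k"])
      show "(nonlin_prim k has_real_derivative g s) (at s)" if "s \<in> {0..l}" for s
        using DERIV_nonlin_prim[OF k] gf[OF that] by simp
      show "nonlin_prim k 0 = 0"
        by (simp add: nonlin_prim_def clamp1_def)
      show "2 * real d * nonlin_prim k s < (real d - 2) * (s * g s)" if "0 < s" "s \<le> l" for s
      proof -
        have d: "real d = 2 * (k + 1)" by (simp add: k_def field_simps)
        show ?thesis
          using nonlin_pohozaev[OF k \<open>0 < s\<close>] gf[of s] that unfolding d by (simp add: algebra_simps)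
      qed
    qed (use assms l in auto)
    have "radial_solution d (nonlin k) l v"
    proof -
      have "g (v r) = nonlin k (v r)" if "r > 0" for r
        using pos[of r] le[of r] that by (intro gf) auto
      with v show ?thesis
        by (simp add: radial_solution_def)
    qed
    \<comment> \<open>Uniqueness is applied to the untruncated equation, so the competitor
      \<open>w\<close> may take any sign or size.\<close>
    then show ?thesis
      using radial_solution_unique[OF _ _ lip] pos by blast
  qed
  moreover have "local_lipschitz (UNIV :: real set) (UNIV - {0}) (\<lambda>_. nonlin k)"
  proof (rule local_lipschitzI)
    fix t x :: real
    obtain L where "L-lipschitz_on {- (\<bar>x\<bar> + 1)..\<bar>x\<bar> + 1} (nonlin k)"
      using lip by blast
    then have "L-lipschitz_on (cball x 1 \<inter> (UNIV - {0})) (nonlin k)"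
      by (rule lipschitz_on_subset) (auto simp: dist_real_def)
    then show "\<exists>u>0. \<exists>L. \<forall>t\<in>cball t u \<inter> UNIV. L-lipschitz_on (cball x u \<inter> (UNIV - {0})) (nonlin k)"
      by (intro exI[of _ 1]) auto
  qed
  moreover have "primitive_from_0 (nonlin k) 1 = 0" "primitive_from_0 (nonlin k) (- 1) = 0"
    using nonlin_prim_small[OF k, of 1] nonlin_prim_small[OF k, of "- 1"]
    by (simp_all add: primitive_nonlin k)
  moreover have "\<forall>s\<in>{- 1<..<1} - {0}. primitive_from_0 (nonlin k) s < 0"
  proof
    fix s :: real assume "s \<in> {- 1<..<1} - {0}"
    then have "\<bar>s\<bar> < 1" "s \<noteq> 0" by auto
    then show "primitive_from_0 (nonlin k) s < 0"
      unfolding primitive_nonlin[OF k] by (rule nonlin_prim_neg[OF k])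
  qed
  moreover have "\<forall>s. nonlin k (- s) = - nonlin k s" "continuous_on UNIV (nonlin k)"
    by (simp_all add: nonlin_minus continuous_on_nonlin k)
  moreover have "\<forall>s. \<bar>s\<bar> \<ge> 1 \<longrightarrow> nonlin k s = \<bar>s\<bar> powr (critical_exponent d - 2) * s"
    unfolding crit by (auto simp: nonlin_large spow_def)
  ultimately show ?thesis
    by - (rule exI[of _ "1::real"], rule exI[of _ "nonlin k"], rule exI[of _ "2::real"],
        intro conjI, simp, assumption+, simp, blast)
qed

end
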